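(* Let $k \geq 2$ be an integer and let $G_1, \dots, G_k$ be finite simple Class 1 graphs with maximum degrees $\Delta(G_1), \dots, \Delta(G_k)$. Let $G = G_1 \square G_2 \square \cdots \square G_k$ and $D = \sum_{i=1}^k \Delta(G_i)$. Suppose $D$ is even and $2\Delta(G_i) < D$ for every $i \in \{1,\dots,k\}$. Suppose that some set $E_0 \subseteq E(G)$ of edges is precolored with colors from a set of at most $D$ colors, such that the distance between any two edges of $E_0$ is at least three. Then this precoloring is extendable, i.e. there is a proper edge coloring of $G$ with $\chi'(G)$ colors in which every edge of $E_0$ receives its prescribed color.
   Context: A graph $G$ is Class 1 if its chromatic index $\chi'(G)$ equals its maximum degree $\Delta(G)$. The Cartesian product $G_1 \square G_2$ has vertex set $V(G_1)\times V(G_2)$, with $(u_1,u_2)$ adjacent to $(v_1,v_2)$ iff either $u_1=v_1$ and $u_2v_2 \in E(G_2)$, or $u_2=v_2$ and $u_1v_1\in E(G_1)$; iterated products are defined accordingly. The distance $d(x,y)$ between vertices is the length of a shortest $x$–$y$ path, and the distance between edges $e=xy$ and $f=zw$ is $\min\{d(x,z),d(x,w),d(y,z),d(y,w)\}$. A precoloring of $E_0$ is extendable if there is a proper edge coloring of the whole graph with $\chi'$ of the graph colors whose restriction to $E_0$ is the prescribed coloring. *)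

theory Defs
  imports Main "HOL-Library.FuncSet" "HOL-Library.Extended_Nat"
begin

definition finite_simple_graph :: "'a set \<Rightarrow> 'a set set \<Rightarrow> bool" where
  "finite_simple_graph V E \<longleftrightarrow> finite V \<and> V \<noteq> {} \<and>
     (\<forall>e\<in>E. \<exists>u v. e = {u, v} \<and> u \<noteq> v \<and> u \<in> V \<and> v \<in> V)"

definition degree :: "'a set set \<Rightarrow> 'a \<Rightarrow> nat" where
  "degree E v = card {e\<in>E. v \<in> e}"

definition max_degree :: "'a set \<Rightarrow> 'a set set \<Rightarrow> nat" where
  "max_degree V E = Max (degree E ` V)"

definition proper_edge_coloring :: "'a set set \<Rightarrow> ('a set \<Rightarrow> 'c) \<Rightarrow> bool" where
  "proper_edge_coloring E c \<longleftrightarrow>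
     (\<forall>e\<in>E. \<forall>f\<in>E. e \<noteq> f \<and> e \<inter> f \<noteq> {} \<longrightarrow> c e \<noteq> c f)"

definition chromatic_index :: "'a set set \<Rightarrow> nat" where
  "chromatic_index E =
     (LEAST n. \<exists>c :: 'a set \<Rightarrow> nat. proper_edge_coloring E c \<and> c ` E \<subseteq> {..<n})"

definition class1 :: "'a set \<Rightarrow> 'a set set \<Rightarrow> bool" where
  "class1 V E \<longleftrightarrow> chromatic_index E = max_degree V E"

fun walk :: "'a set set \<Rightarrow> nat \<Rightarrow> 'a \<Rightarrow> 'a \<Rightarrow> bool" where
  "walk E 0 x y = (x = y)"
| "walk E (Suc n) x y = (\<exists>z. {x, z} \<in> E \<and> walk E n z y)"

text \<open>Distance (infinite if no path).\<close>
definition vdist :: "'a set set \<Rightarrow> 'a \<Rightarrow> 'a \<Rightarrow> enat" where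
  "vdist E x y = (INF n\<in>{n. walk E n x y}. enat n)"

definition edist :: "'a set set \<Rightarrow> 'a set \<Rightarrow> 'a set \<Rightarrow> enat" where
  "edist E e f = (INF p\<in>e \<times> f. vdist E (fst p) (snd p))"

definition prodV :: "nat \<Rightarrow> (nat \<Rightarrow> 'a set) \<Rightarrow> (nat \<Rightarrow> 'a) set" where
  "prodV k V = PiE {..<k} V"

definition prodE :: "nat \<Rightarrow> (nat \<Rightarrow> 'a set) \<Rightarrow> (nat \<Rightarrow> 'a set set) \<Rightarrow> (nat \<Rightarrow> 'a) set set" where
  "prodE k V E = {{x, y} | x y. x \<in> prodV k V \<and> y \<in> prodV k V \<and>
      (\<exists>i<k. {x i, y i} \<in> E i \<and> (\<forall>j<k. j \<noteq> i \<longrightarrow> x j = y j))}"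

end

theory Submission
  imports Defs "HOL-Combinatorics.Transposition"
begin

text \<open>
  Color each factor with \<open>\<Delta>(G\<^sub>i)\<close> colors. This splits the product into \<open>D\<close> matchings, each lying
  in one direction, and matchings \<open>a\<close>, \<open>b\<close> of different directions span only 4-cycles and single
  edges. As no direction has more than \<open>D/2\<close> matchings, the colors can be paired by an involution
  \<open>\<pi>\<close> so that partners have different directions. Let \<open>e\<close> have natural color \<open>a\<close> and prescribed
  color \<open>c\<close>. If the directions of \<open>a\<close> and \<open>c\<close> differ, swap the colors on the \<open>a\<close>-\<open>c\<close> component of \<open>e\<close>.
  Otherwise first swap the \<open>c\<close>-\<open>\<pi> c\<close> components of both ends of \<open>e\<close>; afterwards the 4-cycle through \<open>e\<close>
  that was colored \<open>a\<close>, \<open>\<pi> c\<close> is colored \<open>a\<close>, \<open>c\<close>, and is swapped in a second round. The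
  first-round swaps are compatible because \<open>\<pi>\<close> is a pairing, and distance at least three makes the
  second-round swaps disjoint from each other and undisturbed by the first-round swaps of other edges.
\<close>

section \<open>Pairing colors of different directions\<close>

text \<open>With the \<open>2 * h\<close> colors sorted by \<open>dir\<close>, position
  \<open>n\<close> is paired with \<open>n + h\<close>. If these two had the same direction, so
  would all \<open>h + 1\<close> positions from one to the other, which is more than half of the
  colors.\<close>

lemma pairing_exists:
  fixes dir :: "'c \<Rightarrow> 'l::linorder"
  assumes fin: "finite C" and ev: "even (card C)"
    and half: "\<And>l. 2 * card {c\<in>C. dir c = l} \<le> card C"
  shows "\<exists>\<pi>. \<forall>c\<in>C. \<pi> c \<in> C \<and> \<pi> (\<pi> c) = c \<and> dir (\<pi> c) \<noteq> dir c"
proof -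
  obtain ys where ys: "set ys = C" "distinct ys"
    using finite_distinct_list[OF fin] by blast
  define xs where "xs = sort_key dir ys"
  have xs: "set xs = C" "distinct xs" "sorted (map dir xs)"
    using ys by (auto simp: xs_def)
  have len: "length xs = card C"
    using xs distinct_card by fastforce
  obtain h where h: "card C = 2 * h"
    using ev by blast
  have mono: "dir (xs ! p) \<le> dir (xs ! q)" if "p \<le> q" "q < 2 * h" for p q
    using sorted_nth_mono[OF xs(3), of p q] that len h by simp
  have apart: "dir (xs ! n) \<noteq> dir (xs ! (n + h))" if n: "n < h" for n
  proof
    assume eq: "dir (xs ! n) = dir (xs ! (n + h))"
    have "(!) xs ` {n..n+h} \<subseteq> {c\<in>C. dir c = dir (xs ! n)}"
    proof
      fix c assume "c \<in> (!) xs ` {n..n+h}"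
      then obtain j where j: "c = xs ! j" "n \<le> j" "j \<le> n + h" by auto
      have "dir (xs ! n) \<le> dir (xs ! j)" "dir (xs ! j) \<le> dir (xs ! (n + h))"
        using mono[of n j] mono[of j "n+h"] j n by auto
      then show "c \<in> {c\<in>C. dir c = dir (xs ! n)}"
        using j n eq xs(1) len h by (auto simp: order_antisym)
    qed
    moreover have "card ((!) xs ` {n..n+h}) = Suc h"
      using n xs(2) len h by (subst card_image) (auto intro!: inj_on_nth)
    moreover have "finite {c\<in>C. dir c = dir (xs ! n)}"
      using fin by simp
    ultimately have "Suc h \<le> card {c\<in>C. dir c = dir (xs ! n)}"
      using card_mono by metis
    then show False
      using half[of "dir (xs ! n)"] h by simp
  qed
  define idx where "idx c = (THE n. n < 2 * h \<and> xs ! n = c)" for c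
  have idx: "idx (xs ! n) = n" if n: "n < 2 * h" for n
    unfolding idx_def
  proof (rule the_equality)
    show "m = n" if "m < 2 * h \<and> xs ! m = xs ! n" for m
      using that n nth_eq_iff_index_eq[OF xs(2), of m n] len h by simp
  qed (use n in simp)
  define \<pi> where "\<pi> c = xs ! (if idx c < h then idx c + h else idx c - h)" for c
  have "\<pi> c \<in> C \<and> \<pi> (\<pi> c) = c \<and> dir (\<pi> c) \<noteq> dir c" if c: "c \<in> C" for c
  proof -
    obtain n where n: "c = xs ! n" "n < 2 * h"
      using c xs(1) len h by (auto simp: in_set_conv_nth)
    show ?thesis
    proof (cases "n < h")
      case True
      then have "\<pi> c = xs ! (n + h)" "\<pi> (xs ! (n + h)) = c"
        by (simp_all add: \<pi>_def idx n)
      then show ?thesis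
        using True n apart[OF True] xs(1) len h nth_mem[of "n + h" xs] by simp
    next
      case False
      then have "n - h < h" "n - h + h = n" using n by auto
      moreover from this have "\<pi> c = xs ! (n - h)" "\<pi> (xs ! (n - h)) = c"
        using False by (simp_all add: \<pi>_def idx n)
      ultimately show ?thesis
        using n apart[of "n - h"] xs(1) len h nth_mem[of "n - h" xs] by simp
    qed
  qed
  then show ?thesis by blast
qed

section \<open>Two rounds of color swaps on commuting involutions\<close>

text \<open>
  A matching \<open>a\<close> is encoded as an involution \<open>\<mu> a\<close> fixing the uncovered vertices, which makes the
  degenerate 4-cycles uniform. The recoloring is a family of color permutations \<open>\<rho> x\<close>, one
  per vertex, that agree at both ends of every edge on the color of that edge.
  In the proof, \<open>\<sigma>\<close> is the first round of swaps and \<open>\<tau>\<close> the second; \<open>d e\<close> is the color that \<open>\<sigma>\<close>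
  turns into the prescribed one near \<open>e\<close>.
\<close>

lemma recoloring_exists:
  fixes \<mu> :: "'c \<Rightarrow> 'v \<Rightarrow> 'v" and dir :: "'c \<Rightarrow> 'l"
  assumes invol: "\<And>a x. a \<in> C \<Longrightarrow> \<mu> a (\<mu> a x) = x"
    and commute: "\<And>a b x. a \<in> C \<Longrightarrow> b \<in> C \<Longrightarrow> dir a \<noteq> dir b \<Longrightarrow> \<mu> a (\<mu> b x) = \<mu> b (\<mu> a x)"
    and pairing: "\<And>a. a \<in> C \<Longrightarrow> \<pi> a \<in> C \<and> \<pi> (\<pi> a) = a \<and> dir (\<pi> a) \<noteq> dir a"
    and col: "\<And>e. e \<in> E0 \<Longrightarrow> col e \<in> C" and tgt: "\<And>e. e \<in> E0 \<Longrightarrow> tgt e \<in> C"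
    and edge: "\<And>e x. e \<in> E0 \<Longrightarrow> x \<in> e \<Longrightarrow> e = {x, \<mu> (col e) x}"
    and far: "\<And>e f x y p q. e \<in> E0 \<Longrightarrow> f \<in> E0 \<Longrightarrow> e \<noteq> f \<Longrightarrow> x \<in> e \<Longrightarrow> y \<in> f \<Longrightarrow> p \<in> C \<Longrightarrow> q \<in> C
      \<Longrightarrow> \<mu> p x \<noteq> y \<and> \<mu> p (\<mu> q x) \<noteq> y"
  shows "\<exists>\<rho>. (\<forall>x. inj_on (\<rho> x) C \<and> \<rho> x ` C \<subseteq> C) \<and> (\<forall>x. \<forall>m\<in>C. \<rho> (\<mu> m x) m = \<rho> x m)
    \<and> (\<forall>e\<in>E0. \<forall>x\<in>e. \<rho> x (col e) = tgt e)"
proof -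
  \<comment> \<open>For \<open>p\<close> and \<open>q\<close> of different directions this is the
    component of \<open>y\<close> in the two matchings: a 4-cycle, with fewer vertices if an
    involution has fixed points there.\<close>
  define orb where "orb p q y = {y, \<mu> p y, \<mu> q y, \<mu> p (\<mu> q y)}" for p q y
  \<comment> \<open>Only edges \<open>f\<close> that need the first round count here. Admitting both
    \<open>tgt f\<close> and its partner as \<open>m\<close> makes the condition symmetric under
    \<open>\<pi>\<close>.\<close>
  define P where "P x m \<longleftrightarrow> (\<exists>f\<in>E0. dir (tgt f) = dir (col f) \<and> tgt f \<noteq> col f
      \<and> (m = tgt f \<or> m = \<pi> (tgt f)) \<and> (\<exists>y\<in>f. x \<in> orb m (\<pi> m) y))" for x m
  define \<sigma> where "\<sigma> x m = (if P x m then \<pi> m else m)" for x m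
  define d where "d e = (if dir (tgt e) = dir (col e) then \<pi> (tgt e) else tgt e)" for e
  \<comment> \<open>The 4-cycle through \<open>e\<close> that the second round swaps, or just
    \<open>e\<close> if \<open>d e\<close> leaves its ends uncovered.\<close>
  define T where "T e = e \<union> \<mu> (d e) ` e" for e
  \<comment> \<open>\<open>T_unique\<close> below makes the \<open>THE\<close> well defined. Off all
    sets \<open>T e\<close> the second round does nothing.\<close>
  define \<tau> where "\<tau> x = (if \<exists>e\<in>E0. x \<in> T e then
      let e = (THE e. e \<in> E0 \<and> x \<in> T e) in transpose (col e) (tgt e) else id)" for x
  have d: "d e \<in> C" "dir (d e) \<noteq> dir (col e)" if "e \<in> E0" for e
    using pairing[OF tgt[OF that]] tgt[OF that] by (auto simp: d_def)
  have orb_commute: "orb p q y = orb q p y" if "p \<in> C" "q \<in> C" "dir p \<noteq> dir q" for p q y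
    using that commute[of p q y] by (auto simp: orb_def)
  have orb_closed: "\<mu> p x \<in> orb p q y" if "p \<in> C" "q \<in> C" "x \<in> orb p q y" for p q x y
    using that by (auto simp: orb_def invol)
  have orb_sym: "y \<in> orb p q x" if "p \<in> C" "q \<in> C" "dir p \<noteq> dir q" "x \<in> orb p q y" for p q x y
    using that invol by (auto simp: orb_def commute)
  \<comment> \<open>So \<open>\<sigma> x\<close> swaps or fixes both colors of a pair at once, hence
    is an involution on \<open>C\<close>, even where components of several edges overlap.\<close>
  have P_partner: "P x (\<pi> m) = P x m" if "m \<in> C" for x m
    using pairing[OF that] pairing orb_commute[of m "\<pi> m"] that tgt unfolding P_def
    by (metis (no_types, lifting))
  \<comment> \<open>Components are closed under \<open>\<mu> m\<close>, so the first round acts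
    alike at both ends of an edge of color \<open>m\<close>.\<close>
  have P_edge: "P (\<mu> m x) m = P x m" if "m \<in> C" for x m
  proof -
    have "\<mu> m x \<in> orb m (\<pi> m) y \<longleftrightarrow> x \<in> orb m (\<pi> m) y" for y
      using orb_closed[of m "\<pi> m" x y] orb_closed[of m "\<pi> m" "\<mu> m x" y] pairing[OF that] that
      by (auto simp: invol)
    then show ?thesis unfolding P_def by simp
  qed
  have \<sigma>_C: "\<sigma> x m \<in> C" and \<sigma>_\<sigma>: "\<sigma> x (\<sigma> x m) = m" if "m \<in> C" for x m
    using that pairing[OF that] by (auto simp: \<sigma>_def P_partner)
  have T_edge: "\<mu> (col e) x \<in> T e" "\<mu> (d e) x \<in> T e" if e: "e \<in> E0" and x: "x \<in> T e" for e x
  proof -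
    have closed: "\<mu> (col e) z \<in> e" if "z \<in> e" for z
      using edge[OF e that] by blast
    show "\<mu> (col e) x \<in> T e"
      using x closed commute[OF col[OF e] d(1)[OF e]] d(2)[OF e]
      unfolding T_def by (auto; metis image_eqI)
    show "\<mu> (d e) x \<in> T e"
      using x invol[OF d(1)[OF e]] by (auto simp: T_def)
  qed
  have T_unique: "e = f" if e: "e \<in> E0" "x \<in> T e" and f: "f \<in> E0" "x \<in> T f" for e f x
  proof (rule ccontr)
    assume "e \<noteq> f"
    obtain z where z: "z \<in> e" "x = z \<or> x = \<mu> (d e) z"
      using e by (auto simp: T_def)
    obtain y where y: "y \<in> f" "y = x \<or> y = \<mu> (d f) x"
      using f invol[OF d(1)[OF f(1)]] by (auto simp: T_def)
    note F = far[OF e(1) f(1) \<open>e \<noteq> f\<close> z(1) y(1)]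
    show False
      \<comment> \<open>A step along \<open>d e\<close> and one along \<open>d f\<close> would lead
        from \<open>z\<close> to \<open>y\<close>. Using \<open>d e\<close> twice covers
        \<open>z = y\<close>, as the two steps cancel.\<close>
      using z(2) y(2) F[OF d(1)[OF e(1)] d(1)[OF e(1)]] F[OF d(1)[OF f(1)] d(1)[OF e(1)]]
        invol[OF d(1)[OF e(1)]] by auto
  qed
  have \<tau>_T: "\<tau> x = transpose (col e) (tgt e)" if "e \<in> E0" "x \<in> T e" for e x
  proof -
    have "(THE e. e \<in> E0 \<and> x \<in> T e) = e"
      using that T_unique by (intro the_equality) auto
    then show ?thesis using that by (auto simp: \<tau>_def Let_def)
  qed
  have unaffected: "\<not> (\<exists>y\<in>f. z \<in> orb p q y)"
    if A: "e \<in> E0" "f \<in> E0" "e \<noteq> f" "z \<in> e" "p \<in> C" "q \<in> C" "dir p \<noteq> dir q" for e f z p q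
  proof
    assume "\<exists>y\<in>f. z \<in> orb p q y"
    then obtain y where y: "y \<in> f" "y \<in> orb p q z"
      using orb_sym[OF A(5-7)] by blast
    show False
      using y(2) far[OF A(1-4) y(1), of p q] far[OF A(1-4) y(1), of q q]
        far[OF A(1-4) y(1), of p p] A invol unfolding orb_def by auto
  qed
  \<comment> \<open>A vertex of \<open>T e\<close> may be one step off \<open>e\<close>, and
    \<open>y\<close> two further steps away, which \<open>far\<close> alone does not exclude. But
    \<open>T e\<close> is closed under \<open>\<mu> (col e)\<close>, so that step is free and two
    remain.\<close>
  have \<sigma>_col: "\<sigma> x (col e) = col e" if e: "e \<in> E0" and x: "x \<in> T e" for e x
  proof -
    let ?a = "col e"
    have False if "P x ?a"
    proof -
      obtain f y where f: "f \<in> E0" "dir (tgt f) = dir (col f)" "tgt f \<noteq> col f"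
          "?a = tgt f \<or> ?a = \<pi> (tgt f)" "y \<in> f" "x \<in> orb ?a (\<pi> ?a) y"
        using \<open>P x ?a\<close> unfolding P_def by blast
      have ef: "e \<noteq> f"
        using f pairing[OF tgt[OF f(1)]] by metis
      have pa: "\<pi> ?a \<in> C" "dir ?a \<noteq> dir (\<pi> ?a)"
        using pairing[OF col[OF e]] by auto
      have y: "y \<in> orb ?a (\<pi> ?a) x"
        using orb_sym[OF col[OF e] pa f(6)] .
      then have "y \<in> {x, \<mu> ?a x} \<or> y \<in> \<mu> (\<pi> ?a) ` {x, \<mu> ?a x}"
        using commute[OF col[OF e] pa] unfolding orb_def by auto
      then obtain w where w: "w \<in> T e" "y = w \<or> y = \<mu> (\<pi> ?a) w"
        using T_edge(1)[OF e x] x by auto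
      then obtain z where z: "z \<in> e" "w = z \<or> w = \<mu> (d e) z"
        by (auto simp: T_def)
      note F = far[OF e f(1) ef z(1) f(5)]
      show False
        using w(2) z(2) F[OF pa(1) d(1)[OF e]] F[OF d(1)[OF e] d(1)[OF e]] 
          invol[OF d(1)[OF e]] by auto
    qed
    then show ?thesis by (auto simp: \<sigma>_def)
  qed
  have \<sigma>_d: "\<sigma> x (d e) = tgt e" if e: "e \<in> E0" "tgt e \<noteq> col e" and x: "x \<in> T e" for e x
  proof -
    let ?c = "tgt e"
    have pc: "\<pi> ?c \<in> C" "\<pi> (\<pi> ?c) = ?c" "dir ?c \<noteq> dir (\<pi> ?c)"
      using pairing[OF tgt[OF e(1)]] by auto
    obtain z where z: "z \<in> e" "x = z \<or> x = \<mu> (d e) z"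
      using x by (auto simp: T_def)
    show ?thesis
    proof (cases "dir ?c = dir (col e)")
      case True
      then have "d e = \<pi> ?c" by (simp add: d_def)
      \<comment> \<open>The edge \<open>e\<close> itself is the witness: its own first-round swap
        turns \<open>\<pi> ?c\<close> into \<open>?c\<close> here.\<close>
      then have "P x (d e)"
        unfolding P_def using e True z pc by (auto simp: orb_def)
      then show ?thesis using pc \<open>d e = \<pi> ?c\<close> by (simp add: \<sigma>_def)
    next
      case False
      then have de: "d e = ?c" by (simp add: d_def)
      have "\<not> P x ?c"
      proof
        assume "P x ?c"
        then obtain f y where f: "f \<in> E0" "dir (tgt f) = dir (col f)" "y \<in> f" "x \<in> orb ?c (\<pi> ?c) y"
          unfolding P_def by blast
        then have "e \<noteq> f" using False by auto
        \<comment> \<open>Since \<open>d e = ?c\<close>, moving from \<open>x\<close> back to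
          \<open>z\<close> stays in the component, so \<open>unaffected\<close> applies to the
          endpoint \<open>z\<close>.\<close>
        moreover have "z \<in> orb ?c (\<pi> ?c) y"
          using z(2) f(4) orb_closed[OF tgt[OF e(1)] pc(1) f(4)] invol[OF tgt[OF e(1)]]
          by (auto simp: de)
        ultimately show False
          using unaffected[OF e(1) f(1) _ z(1) tgt[OF e(1)] pc(1,3)] f(3) by blast
      qed
      then show ?thesis by (simp add: de \<sigma>_def)
    qed
  qed
  define \<rho> where "\<rho> x m = \<tau> x (\<sigma> x m)" for x m
  have \<tau>_bij: "bij (\<tau> x)" and \<tau>_C: "m \<in> C \<Longrightarrow> \<tau> x m \<in> C" for x m
  proof -
    have "bij (\<tau> x) \<and> (m \<in> C \<longrightarrow> \<tau> x m \<in> C)"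
    proof (cases "\<exists>e\<in>E0. x \<in> T e")
      case True
      then obtain e where e: "e \<in> E0" "x \<in> T e" by blast
      then show ?thesis
        using \<tau>_T[OF e] col[OF e(1)] tgt[OF e(1)] by (auto simp: transpose_def)
    qed (auto simp: \<tau>_def)
    then show "bij (\<tau> x)" "m \<in> C \<Longrightarrow> \<tau> x m \<in> C" by auto
  qed
  \<comment> \<open>As \<open>\<sigma> x\<close> is an involution, only \<open>col e\<close> and
    \<open>d e\<close> are taken to the swapped colors. Edges of these colors stay inside
    \<open>T e\<close>, so the other end undergoes the same swap.\<close>
  have \<tau>_\<sigma>: "\<tau> (\<mu> m x) (\<sigma> x m) = transpose (col e) (tgt e) (\<sigma> x m)"
    if e: "e \<in> E0" "x \<in> T e" and m: "m \<in> C" and swapped: "\<sigma> x m \<in> {col e, tgt e}" "tgt e \<noteq> col e"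
    for e x m
  proof -
    have "m = col e \<or> m = d e"
      using swapped \<sigma>_col[OF e] \<sigma>_d[OF e(1) swapped(2) e(2)] \<sigma>_\<sigma>[OF m, of x]
        \<sigma>_\<sigma>[OF col[OF e(1)], of x] \<sigma>_\<sigma>[OF d(1)[OF e(1)], of x] by auto
    then have "\<mu> m x \<in> T e" using T_edge[OF e] by auto
    then show ?thesis using \<tau>_T e(1) by simp
  qed
  have half_edge: "\<tau> (\<mu> m x) (\<sigma> x m) = \<tau> x (\<sigma> x m)" if m: "m \<in> C" and moved: "\<tau> x (\<sigma> x m) \<noteq> \<sigma> x m" for x m
  proof -
    obtain e where e: "e \<in> E0" "x \<in> T e"
      using moved by (auto simp: \<tau>_def split: if_splits)
    then have "\<sigma> x m \<in> {col e, tgt e}" "tgt e \<noteq> col e"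
      using moved \<tau>_T[OF e] by (auto simp: transpose_def split: if_splits)
    then show ?thesis using \<tau>_\<sigma>[OF e m] \<tau>_T[OF e] by simp
  qed
  have "\<rho> (\<mu> m x) m = \<rho> x m" if m: "m \<in> C" for x m
  proof -
    have s: "\<sigma> (\<mu> m x) m = \<sigma> x m"
      using P_edge[OF m] by (simp add: \<sigma>_def)
    \<comment> \<open>If the second round moves the color at either end, \<open>half_edge\<close>
      from that end gives equality. Otherwise both ends keep \<open>\<sigma> x m\<close>.\<close>
    show ?thesis
      using half_edge[OF m, of x] half_edge[OF m, of "\<mu> m x"] unfolding s invol[OF m] \<rho>_def by metis
  qed
  moreover have "inj_on (\<rho> x) C \<and> \<rho> x ` C \<subseteq> C" for x
  proof
    show "inj_on (\<rho> x) C"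
      unfolding \<rho>_def by (rule inj_onI) (metis \<tau>_bij bij_is_inj injD \<sigma>_\<sigma>)
    show "\<rho> x ` C \<subseteq> C"
      using \<tau>_C \<sigma>_C by (auto simp: \<rho>_def)
  qed
  moreover have "\<rho> x (col e) = tgt e" if "e \<in> E0" "x \<in> e" for e x
  proof -
    have "x \<in> T e" using that by (simp add: T_def)
    then show ?thesis using \<sigma>_col \<tau>_T that by (simp add: \<rho>_def)
  qed
  ultimately show ?thesis by blast
qed

section \<open>Edge colorings of a single graph and their matchings\<close>

lemma edge_endpoints:
  assumes "finite_simple_graph V E" "{y, z} \<in> E"
  shows "y \<noteq> z" "y \<in> V" "z \<in> V"
proof -
  obtain u v where "{y, z} = {u, v}" "u \<noteq> v" "u \<in> V" "v \<in> V"
    using assms unfolding finite_simple_graph_def by blast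
  then show "y \<noteq> z" "y \<in> V" "z \<in> V" by (auto simp: doubleton_eq_iff)
qed

lemma finite_edges:
  assumes "finite_simple_graph V E"
  shows "finite E"
proof (rule finite_subset)
  show "finite (Pow V)"
    using assms unfolding finite_simple_graph_def by (simp only: finite_Pow_iff)
  show "E \<subseteq> Pow V"
  proof
    fix e assume "e \<in> E"
    then obtain u v where "e = {u, v}" "u \<in> V" "v \<in> V"
      using assms unfolding finite_simple_graph_def by meson
    then show "e \<in> Pow V" by simp
  qed
qed

text \<open>The minimum is attained because an injective numbering of the finitely many edges is a
  proper coloring.\<close>

lemma chromatic_index_coloring:
  assumes "finite E"
  shows "\<exists>c :: 'a set \<Rightarrow> nat. proper_edge_coloring E c \<and> c ` E \<subseteq> {..<chromatic_index E}"
proof -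
  obtain h n where h: "h ` E = {i::nat. i < n}" "inj_on h E"
    using finite_imp_inj_to_nat_seg[OF assms] by blast
  then have "proper_edge_coloring E h \<and> h ` E \<subseteq> {..<n}"
    by (auto simp: proper_edge_coloring_def inj_on_eq_iff)
  then show ?thesis
    unfolding chromatic_index_def
    by (intro LeastI[of "\<lambda>n. \<exists>c :: 'a set \<Rightarrow> nat. proper_edge_coloring E c \<and> c ` E \<subseteq> {..<n}" n]) blast
qed

text \<open>The neighbor of \<open>y\<close> along color \<open>m\<close>, or \<open>y\<close> itself if there is none.\<close>

definition partner :: "'a set set \<Rightarrow> ('a set \<Rightarrow> nat) \<Rightarrow> nat \<Rightarrow> 'a \<Rightarrow> 'a" where
  "partner E c m y = (if \<exists>z. {y, z} \<in> E \<and> c {y, z} = m then THE z. {y, z} \<in> E \<and> c {y, z} = m else y)"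

lemma partner_eq:
  assumes "proper_edge_coloring E c" "{y, z} \<in> E" "c {y, z} = m"
  shows "partner E c m y = z"
proof -
  have "w = z" if "{y, w} \<in> E" "c {y, w} = m" for w
  proof -
    have "{y, w} = {y, z}"
      using assms that unfolding proper_edge_coloring_def by (metis Int_insert_left_if1 insertI1 insert_not_empty)
    then show ?thesis by (auto simp: doubleton_eq_iff)
  qed
  then have "(THE z. {y, z} \<in> E \<and> c {y, z} = m) = z"
    using assms(2,3) by (intro the_equality) blast+
  moreover have "\<exists>z. {y, z} \<in> E \<and> c {y, z} = m" using assms(2,3) by blast
  ultimately show ?thesis unfolding partner_def by (simp only: if_True)
qed

lemma partner_cases:
  assumes "proper_edge_coloring E c"
  shows "partner E c m y = y \<or> {y, partner E c m y} \<in> E \<and> c {y, partner E c m y} = m"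
proof (cases "\<exists>z. {y, z} \<in> E \<and> c {y, z} = m")
  case True
  then obtain z where "{y, z} \<in> E" "c {y, z} = m" by blast
  then show ?thesis using partner_eq[OF assms] by simp
next
  case False
  then have "partner E c m y = y" unfolding partner_def by (simp only: if_False)
  then show ?thesis ..
qed

lemma partner_involution:
  assumes "proper_edge_coloring E c"
  shows "partner E c m (partner E c m y) = y"
  using partner_cases[OF assms, of m y]
proof
  assume "{y, partner E c m y} \<in> E \<and> c {y, partner E c m y} = m"
  then show ?thesis using partner_eq[OF assms, of "partner E c m y" y m] by (simp add: insert_commute)
qed simp

text \<open>At a vertex \<open>v\<close> of maximum degree the incident edges have distinct colors,
  as many as are available, so every color occurs. Such vertices later bound the chromatic index of
  the product from below.\<close>

lemma class1_coloring:
  assumes G: "finite_simple_graph V E" "class1 V E"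
  obtains c v where "proper_edge_coloring E c" "c ` E \<subseteq> {..<max_degree V E}" "v \<in> V"
    "\<And>m. m < max_degree V E \<Longrightarrow> partner E c m v \<noteq> v"
proof -
  obtain c where c: "proper_edge_coloring E c" "c ` E \<subseteq> {..<max_degree V E}"
    using chromatic_index_coloring[OF finite_edges[OF G(1)]] G(2) by (auto simp: class1_def)
  have "max_degree V E \<in> degree E ` V"
    unfolding max_degree_def using G(1) by (intro Max_in) (auto simp: finite_simple_graph_def)
  then obtain v where v: "v \<in> V" "card {e\<in>E. v \<in> e} = max_degree V E"
    by (auto simp: degree_def)
  have "inj_on c {e\<in>E. v \<in> e}"
    using c(1) by (intro inj_onI) (auto simp: proper_edge_coloring_def)
  then have "c ` {e\<in>E. v \<in> e} = {..<max_degree V E}"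
    using c(2) v(2) by (intro card_subset_eq) (auto simp: card_image)
  moreover have "partner E c m v \<noteq> v" if m: "m \<in> c ` {e\<in>E. v \<in> e}" for m
  proof -
    obtain e where e: "e \<in> E" "v \<in> e" "c e = m" using m by auto
    then obtain z where "e = {v, z}" "z \<noteq> v"
      using G(1) unfolding finite_simple_graph_def by (metis insert_commute insertE singletonD)
    then show ?thesis using partner_eq[OF c(1)] e by metis
  qed
  ultimately show ?thesis by (intro that[OF c v(1)]) simp
qed

section \<open>Distance bounds and naming of colors\<close>

lemma edist_le_walk:
  assumes "x \<in> e" "y \<in> f" "walk E n x y"
  shows "edist E e f \<le> enat n"
proof -
  have "edist E e f \<le> vdist E x y"
    unfolding edist_def using assms by (intro INF_lower2[of "(x, y)"]) auto
  also have "\<dots> \<le> enat n"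
    unfolding vdist_def using assms by (intro INF_lower) auto
  finally show ?thesis .
qed

text \<open>Names the natural colors by numbers so that every prescribed number is a name; when
  there are fewer prescribed numbers than colors, fresh numbers fill up.\<close>

lemma inj_extension:
  fixes A :: "nat set"
  assumes "finite A" "finite C" "card A \<le> card C"
  obtains h where "inj_on h C" "A \<subseteq> h ` C"
proof -
  obtain H where H: "A \<subseteq> H" "card H = card C" "finite H"
  proof -
    obtain B where "finite B" "card B = card C - card A" "B \<subseteq> - A"
      using infinite_arbitrarily_large[of "- A" "card C - card A"] assms(1) by auto
    moreover from this have "A \<inter> B = {}" by blast
    ultimately show ?thesis
      using that[of "A \<union> B"] assms by (simp add: card_Un_disjoint)
  qed
  obtain h where "bij_betw h C H"
    using finite_same_card_bij[OF assms(2) H(3)] H(2) by auto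
  then have "inj_on h C" "h ` C = H" by (simp_all add: bij_betw_def)
  then show ?thesis using that[of h] H(1) by simp
qed

section \<open>The product graph\<close>

theorem theorem2:
  fixes k :: nat and V :: "nat \<Rightarrow> 'a set" and E :: "nat \<Rightarrow> 'a set set"
    and E0 :: "(nat \<Rightarrow> 'a) set set" and \<phi> :: "(nat \<Rightarrow> 'a) set \<Rightarrow> nat"
  assumes "k \<ge> 2"
    and "\<And>i. i < k \<Longrightarrow> finite_simple_graph (V i) (E i)"
    and "\<And>i. i < k \<Longrightarrow> class1 (V i) (E i)"
    and "even (\<Sum>i<k. max_degree (V i) (E i))"
    and "\<And>i. i < k \<Longrightarrow> 2 * max_degree (V i) (E i) < (\<Sum>j<k. max_degree (V j) (E j))"
    and "E0 \<subseteq> prodE k V E"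
    and "card (\<phi> ` E0) \<le> (\<Sum>i<k. max_degree (V i) (E i))"
    and "\<And>e f. e \<in> E0 \<Longrightarrow> f \<in> E0 \<Longrightarrow> e \<noteq> f \<Longrightarrow> edist (prodE k V E) e f \<ge> 3"
  shows "\<exists>c :: (nat \<Rightarrow> 'a) set \<Rightarrow> nat.
           proper_edge_coloring (prodE k V E) c
           \<and> card (c ` prodE k V E) \<le> chromatic_index (prodE k V E)
           \<and> (\<forall>e\<in>E0. c e = \<phi> e)"
proof -
  define \<Delta> where "\<Delta> i = max_degree (V i) (E i)" for i
  \<comment> \<open>A natural color is a factor together with a color of that factor, so
    \<open>fst\<close> is its direction.\<close>
  define C where "C = Sigma {..<k} (\<lambda>i. {..<\<Delta> i})"
  let ?X = "prodV k V" and ?E = "prodE k V E"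
  have finC: "finite C" and cardC: "card C = (\<Sum>i<k. \<Delta> i)"
    by (simp_all add: C_def)
  have "\<forall>i. \<exists>c v. i < k \<longrightarrow> proper_edge_coloring (E i) c \<and> c ` E i \<subseteq> {..<\<Delta> i} \<and> v \<in> V i
      \<and> (\<forall>m<\<Delta> i. partner (E i) c m v \<noteq> v)"
    using class1_coloring[OF assms(2,3)] unfolding \<Delta>_def by metis
  then obtain cl v where cl: "\<And>i. i < k \<Longrightarrow> proper_edge_coloring (E i) (cl i)"
      "\<And>i. i < k \<Longrightarrow> cl i ` E i \<subseteq> {..<\<Delta> i}"
    and v: "\<And>i. i < k \<Longrightarrow> v i \<in> V i" "\<And>i m. i < k \<Longrightarrow> m < \<Delta> i \<Longrightarrow> partner (E i) (cl i) m (v i) \<noteq> v i"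
    by metis
  define \<mu> where "\<mu> a x = x(fst a := partner (E (fst a)) (cl (fst a)) (snd a) (x (fst a)))"
    for a :: "nat \<times> nat" and x :: "nat \<Rightarrow> 'a"
  have invol: "\<mu> a (\<mu> a x) = x" if "a \<in> C" for a x
    using that cl(1) by (auto simp: C_def \<mu>_def partner_involution)
  have commute: "\<mu> a (\<mu> b x) = \<mu> b (\<mu> a x)" if "fst a \<noteq> fst b" for a b x
    using that by (auto simp: \<mu>_def fun_upd_twist)
  have \<mu>_edge: "\<mu> a x \<in> ?X" "{x, \<mu> a x} \<in> ?E" if a: "a \<in> C" and x: "x \<in> ?X" and ne: "\<mu> a x \<noteq> x" for a x
  proof -
    obtain i m where im: "a = (i, m)" "i < k" using a by (auto simp: C_def)
    have ed: "{x i, \<mu> a x i} \<in> E i"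
      using partner_cases[OF cl(1)[OF im(2)], of m "x i"] ne im by (simp add: \<mu>_def fun_upd_idem_iff)
    then have "\<mu> a x i \<in> V i" using edge_endpoints assms(2) im by metis
    then show X: "\<mu> a x \<in> ?X"
      using x im by (auto simp: prodV_def \<mu>_def PiE_iff extensional_def)
    show "{x, \<mu> a x} \<in> ?E"
      unfolding prodE_def using X x ed im 
      by (intro CollectI exI[of _ x] exI[of _ "\<mu> a x"] exI[of _ i] conjI) (simp_all add: \<mu>_def)
  qed
  have \<mu>_X: "\<mu> a x \<in> ?X" if "a \<in> C" "x \<in> ?X" for a x
    using \<mu>_edge that by metis
  have color_unique: "a = b" if a: "a \<in> C" and b: "b \<in> C" and eq: "\<mu> a x = \<mu> b x" and ne: "\<mu> a x \<noteq> x" for a b x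
  proof -
    have "fst a = fst b"
      using eq ne unfolding \<mu>_def by (metis fun_upd_apply fun_upd_triv)
    moreover have "cl (fst a) {x (fst a), \<mu> a x (fst a)} = snd a" if "a \<in> C" "\<mu> a x \<noteq> x" for a
      using partner_cases[OF cl(1), of "fst a" "snd a" "x (fst a)"] that
      by (auto simp: C_def \<mu>_def fun_upd_idem_iff)
    ultimately show ?thesis using a b eq ne by (metis prod.expand)
  qed
  have edge_ex: "\<exists>a\<in>C. \<exists>x\<in>?X. e = {x, \<mu> a x} \<and> \<mu> a x \<noteq> x" if e: "e \<in> ?E" for e
  proof -
    obtain x y i where xy: "e = {x, y}" "x \<in> ?X" "y \<in> ?X" "i < k" "{x i, y i} \<in> E i"
        "\<And>j. j < k \<Longrightarrow> j \<noteq> i \<Longrightarrow> x j = y j"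
      using e unfolding prodE_def by blast
    define m where "m = cl i {x i, y i}"
    have "m < \<Delta> i" using cl(2) xy m_def by blast
    then have "(i, m) \<in> C" using xy by (simp add: C_def)
    \<comment> \<open>Indices from \<open>k\<close> on also agree: both functions are extensional
      and take the default value there.\<close>
    moreover have "x j = y j" if "j \<noteq> i" for j
      using xy that by (cases "j < k") (auto simp: prodV_def PiE_iff extensional_def)
    then have "\<mu> (i, m) x = y"
      using partner_eq[OF cl(1)[OF xy(4)] xy(5)] by (auto simp: \<mu>_def m_def)
    moreover have "x i \<noteq> y i" using edge_endpoints[OF assms(2)] xy by blast
    ultimately show ?thesis using xy by metis
  qed
  obtain col where col: "\<And>e. e \<in> ?E \<Longrightarrow>
      col e \<in> C \<and> (\<exists>x\<in>?X. e = {x, \<mu> (col e) x} \<and> \<mu> (col e) x \<noteq> x)"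
    using edge_ex by metis
  have edge: "e = {x, \<mu> (col e) x} \<and> \<mu> (col e) x \<noteq> x \<and> x \<in> ?X" if e: "e \<in> ?E" "x \<in> e" for e x
  proof -
    obtain z where z: "z \<in> ?X" "e = {z, \<mu> (col e) z}" "\<mu> (col e) z \<noteq> z" "col e \<in> C"
      using col[OF e(1)] by blast
    then consider "x = z" | "x = \<mu> (col e) z" using e(2) by blast
    then show ?thesis
    proof cases
      case 2
      then have "\<mu> (col e) x = z" using invol z by simp
      then show ?thesis using z 2 \<mu>_X by (simp add: insert_commute)
    qed (use z in simp)
  qed
  have far: "\<mu> p x \<noteq> y \<and> \<mu> p (\<mu> q x) \<noteq> y"
    if e: "e \<in> E0" and f: "f \<in> E0" and ef: "e \<noteq> f" and xy: "x \<in> e" "y \<in> f" and pq: "p \<in> C" "q \<in> C" for e f x y p q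
  proof -
    \<comment> \<open>Each application of \<open>\<mu>\<close> follows an edge or stands still, so
      reaching \<open>y\<close> by at most two of them would give a walk shorter than 3.\<close>
    have no_walk: "\<not> walk ?E n x y" if "n < 3" for n
    proof
      assume "walk ?E n x y"
      then have "3 \<le> enat n"
        using edist_le_walk[OF xy] assms(8)[OF e f ef] order_trans by blast
      then show False using that by (simp add: numeral_eq_enat)
    qed
    have x: "x \<in> ?X" using edge e xy assms(6) by blast
    have step: "z = \<mu> a z \<or> {z, \<mu> a z} \<in> ?E" if "a \<in> C" "z \<in> ?X" for a z
      using \<mu>_edge(2)[OF that] by metis
    have w0: "x \<noteq> y" using no_walk[of 0] by simp
    have w1: "{x, y} \<notin> ?E" using no_walk[of 1] by simp
    have w2: "\<not> ({x, z} \<in> ?E \<and> {z, y} \<in> ?E)" for z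
      using no_walk[of 2] by (auto simp: numeral_2_eq_2)
    show ?thesis
      using w0 w1 w2 step[OF pq(1) x] step[OF pq(2) x] step[OF pq(1) \<mu>_X[OF pq(2) x]] by metis
  qed
  have "\<exists>\<pi>. \<forall>a\<in>C. \<pi> a \<in> C \<and> \<pi> (\<pi> a) = a \<and> fst (\<pi> a) \<noteq> fst a"
  proof (rule pairing_exists[OF finC])
    show "even (card C)" using assms(4) cardC by (simp add: \<Delta>_def)
    show "2 * card {a\<in>C. fst a = i} \<le> card C" for i
    proof (cases "i < k")
      case True
      then have "{a\<in>C. fst a = i} = {i} \<times> {..<\<Delta> i}" by (auto simp: C_def)
      then show ?thesis using assms(5)[OF True] cardC by (simp add: \<Delta>_def)
    next
      case False
      then have none: "{a\<in>C. fst a = i} = {}" by (auto simp: C_def)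
      show ?thesis unfolding none by simp
    qed
  qed
  then obtain \<pi> where \<pi>: "\<And>a. a \<in> C \<Longrightarrow> \<pi> a \<in> C \<and> \<pi> (\<pi> a) = a \<and> fst (\<pi> a) \<noteq> fst a"
    by blast
  have finE: "finite ?E"
  proof -
    have "finite ?X"
      using assms(2) unfolding prodV_def finite_simple_graph_def by (intro finite_PiE) auto
    moreover have "?E \<subseteq> Pow ?X" by (auto simp: prodE_def)
    ultimately show ?thesis using finite_subset by blast
  qed
  then have "finite (\<phi> ` E0)" using assms(6) finite_subset by blast
  then obtain h where h: "inj_on h C" "\<phi> ` E0 \<subseteq> h ` C"
    using inj_extension[OF _ finC] assms(7) cardC unfolding \<Delta>_def by metis
  define tgt where "tgt e = inv_into C h (\<phi> e)" for e
  have tgt: "tgt e \<in> C" "h (tgt e) = \<phi> e" if "e \<in> E0" for e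
    using h(2) that by (auto simp: tgt_def inv_into_into f_inv_into_f image_subset_iff)
  have "\<exists>\<rho>. (\<forall>x. inj_on (\<rho> x) C \<and> \<rho> x ` C \<subseteq> C) \<and> (\<forall>x. \<forall>m\<in>C. \<rho> (\<mu> m x) m = \<rho> x m)
    \<and> (\<forall>e\<in>E0. \<forall>x\<in>e. \<rho> x (col e) = tgt e)"
  proof (rule recoloring_exists[where \<pi> = \<pi> and dir = fst])
    show "col e \<in> C" if "e \<in> E0" for e
      using col assms(6) that by blast
    show "e = {x, \<mu> (col e) x}" if "e \<in> E0" "x \<in> e" for e x
      using edge assms(6) that by blast
  qed (rule invol commute \<pi> tgt(1) far; assumption)+
  then obtain \<rho> where \<rho>_all: "(\<forall>x. inj_on (\<rho> x) C \<and> \<rho> x ` C \<subseteq> C)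
      \<and> (\<forall>x. \<forall>m\<in>C. \<rho> (\<mu> m x) m = \<rho> x m) \<and> (\<forall>e\<in>E0. \<forall>x\<in>e. \<rho> x (col e) = tgt e)" ..
  have \<rho>: "inj_on (\<rho> x) C" "m \<in> C \<Longrightarrow> \<rho> x m \<in> C" "m \<in> C \<Longrightarrow> \<rho> (\<mu> m x) m = \<rho> x m"
      "e \<in> E0 \<Longrightarrow> x \<in> e \<Longrightarrow> \<rho> x (col e) = tgt e" for x m e
    using \<rho>_all by (simp_all add: image_subset_iff)
  \<comment> \<open>The choice of endpoint is harmless, since \<open>\<rho>\<close> agrees at both
    ends on the natural color of the edge.\<close>
  define c where "c e = h (\<rho> (SOME x. x \<in> e) (col e))" for e
  have c: "c e = h (\<rho> x (col e))" if e: "e \<in> ?E" "x \<in> e" for e x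
  proof -
    have "(SOME x. x \<in> e) \<in> e" using e(2) some_in_eq[of e] by blast
    then have "(SOME x. x \<in> e) = x \<or> (SOME x. x \<in> e) = \<mu> (col e) x" using edge[OF e] by blast
    then have "\<rho> (SOME x. x \<in> e) (col e) = \<rho> x (col e)"
      using \<rho>(3)[of "col e" x] col[OF e(1)] by metis
    then show ?thesis by (simp add: c_def)
  qed
  have "c e \<noteq> c f" if e: "e \<in> ?E" and f: "f \<in> ?E" and ef: "e \<noteq> f" "e \<inter> f \<noteq> {}" for e f
  proof
    obtain x where x: "x \<in> e" "x \<in> f" using ef(2) by blast
    assume "c e = c f"
    then have "\<rho> x (col e) = \<rho> x (col f)"
      using c[OF e x(1)] c[OF f x(2)] inj_onD[OF h(1)] \<rho>(2) col[OF e] col[OF f] by simp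
    then have "col e = col f"
      using inj_onD[OF \<rho>(1)[of x]] col[OF e] col[OF f] by simp
    then show False using edge[OF e x(1)] edge[OF f x(2)] ef(1) by metis
  qed
  then have proper: "proper_edge_coloring ?E c"
    by (simp add: proper_edge_coloring_def)
  have "c ` ?E \<subseteq> h ` C"
    unfolding c_def using col \<rho>(2) by (intro image_subsetI imageI) blast
  then have "card (c ` ?E) \<le> card C"
    using finC by (meson card_image_le card_mono finite_imageI order_trans)
  also have "\<dots> \<le> chromatic_index ?E"
  proof -
    obtain g :: "(nat \<Rightarrow> 'a) set \<Rightarrow> nat" where g: "proper_edge_coloring ?E g" "g ` ?E \<subseteq> {..<chromatic_index ?E}"
      using chromatic_index_coloring[OF finE] by blast
    \<comment> \<open>Each coordinate meets all colors of its factor, so \<open>x\<close> has an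
      edge of every natural color, and any proper coloring \<open>g\<close> needs
      \<open>card C\<close> colors at \<open>x\<close>.\<close>
    define x where "x = restrict v {..<k}"
    have x: "x \<in> ?X" using v(1) by (auto simp: x_def prodV_def)
    have ne: "\<mu> a x \<noteq> x" if "a \<in> C" for a
      using v(2)[of "fst a" "snd a"] that by (auto simp: C_def \<mu>_def x_def fun_upd_idem_iff)
    have "inj_on (\<lambda>a. g {x, \<mu> a x}) C"
    proof (rule inj_onI)
      fix a b assume ab: "a \<in> C" "b \<in> C" "g {x, \<mu> a x} = g {x, \<mu> b x}"
      have "{x, \<mu> a x} = {x, \<mu> b x}"
        using g(1)[unfolded proper_edge_coloring_def, rule_format,
            OF \<mu>_edge(2)[OF ab(1) x ne[OF ab(1)]] \<mu>_edge(2)[OF ab(2) x ne[OF ab(2)]]] ab(3) by blast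
      then have "\<mu> a x = \<mu> b x"
        by (auto simp: doubleton_eq_iff)
      then show "a = b"
        using color_unique ab ne by blast
    qed
    moreover have "(\<lambda>a. g {x, \<mu> a x}) ` C \<subseteq> {..<chromatic_index ?E}"
      using g(2) \<mu>_edge(2)[OF _ x ne] by blast
    ultimately show ?thesis
      using card_inj_on_le[of _ C "{..<chromatic_index ?E}"] by simp
  qed
  finally have "card (c ` ?E) \<le> chromatic_index ?E" .
  moreover have "c e = \<phi> e" if e: "e \<in> E0" for e
  proof -
    obtain x where "x \<in> e" using col e assms(6) by blast
    then show ?thesis using c \<rho>(4) tgt(2) e assms(6) by (metis subsetD)
  qed
  ultimately show ?thesis using proper by blast
qed

end
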